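(* There is a function $\delta:\mathbb{N}\to\mathbb{R}$ with $\delta(n)\to0$ as $n\to\infty$ such that for every $n\ge 2$, every $\varepsilon\in(0,1)$, and every pair of starting permutations of $n$ items, for the pairwise coupling on permutations described in the context, the number of steps before the probability of coalescence is at least $1-\varepsilon$ is at most $$\left(\frac{2}{\pi^2}+\delta(n)\right)n^3\log\frac{10n}{\varepsilon}.$$
   Context: The Markov chain on permutations of $n$ items: at each step choose uniformly one of the $n-1$ pairs of adjacent positions and, with probability $1/2$, exchange the items in those positions. The pairwise coupling of two copies of this chain: at each step the choice of the adjacent pair is the same in the two copies, and the decision whether or not to exchange is the same in both copies, unless performing the exchange in one copy but not in the other would decrease the Hamming distance between the two permutations (the number of positions at which they differ), in which case the exchange is performed in exactly one of the two copies, each with probability $1/2$. Coalescence at time $t$ means that the two permutations are equal at time $t$. $\log$ is the natural logarithm. *)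

theory Defs
  imports "HOL-Probability.Probability" "HOL-Combinatorics.Permutations"
begin

text \<open>
  A permutation \<open>\<sigma>\<close> of \<open>n\<close> items is a function with \<open>\<sigma> permutes {..<n}\<close>; it maps a position
  to the item at that position. The \<open>n - 1\<close> pairs of adjacent positions are \<open>(i, i + 1)\<close>
  for \<open>i < n - 1\<close>.
\<close>

definition exchange :: "nat \<Rightarrow> (nat \<Rightarrow> nat) \<Rightarrow> nat \<Rightarrow> nat" where
  "exchange i \<sigma> = \<sigma> \<circ> Transposition.transpose i (Suc i)"

definition hamming :: "nat \<Rightarrow> (nat \<Rightarrow> nat) \<Rightarrow> (nat \<Rightarrow> nat) \<Rightarrow> nat" where
  "hamming n \<sigma> \<tau> = card {i \<in> {..<n}. \<sigma> i \<noteq> \<tau> i}"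

definition shuffle_step :: "nat \<Rightarrow> (nat \<Rightarrow> nat) \<Rightarrow> (nat \<Rightarrow> nat) pmf" where
  "shuffle_step n \<sigma> =
     do {
       i \<leftarrow> pmf_of_set {..<n - 1};
       b \<leftarrow> bernoulli_pmf (1 / 2);
       return_pmf (if b then exchange i \<sigma> else \<sigma>)
     }"

definition exchange_in_one_decreases :: "nat \<Rightarrow> nat \<Rightarrow> (nat \<Rightarrow> nat) \<Rightarrow> (nat \<Rightarrow> nat) \<Rightarrow> bool" where
  "exchange_in_one_decreases n i \<sigma> \<tau> \<longleftrightarrow>
     hamming n (exchange i \<sigma>) \<tau> < hamming n \<sigma> \<tau> \<or>
     hamming n \<sigma> (exchange i \<tau>) < hamming n \<sigma> \<tau>"

definition pairwise_step ::
  "nat \<Rightarrow> (nat \<Rightarrow> nat) \<times> (nat \<Rightarrow> nat) \<Rightarrow> ((nat \<Rightarrow> nat) \<times> (nat \<Rightarrow> nat)) pmf" where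
  "pairwise_step n = (\<lambda>(\<sigma>, \<tau>).
     do {
       i \<leftarrow> pmf_of_set {..<n - 1};
       b \<leftarrow> bernoulli_pmf (1 / 2);
       return_pmf
         (if exchange_in_one_decreases n i \<sigma> \<tau>
          then (if b then (exchange i \<sigma>, \<tau>) else (\<sigma>, exchange i \<tau>))
          else (if b then (exchange i \<sigma>, exchange i \<tau>) else (\<sigma>, \<tau>)))
     })"

primrec pairwise_law ::
  "nat \<Rightarrow> (nat \<Rightarrow> nat) \<times> (nat \<Rightarrow> nat) \<Rightarrow> nat \<Rightarrow> ((nat \<Rightarrow> nat) \<times> (nat \<Rightarrow> nat)) pmf" where
  "pairwise_law n p 0 = return_pmf p"
| "pairwise_law n p (Suc t) = bind_pmf (pairwise_law n p t) (pairwise_step n)"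

definition prob_coalesced :: "nat \<Rightarrow> (nat \<Rightarrow> nat) \<Rightarrow> (nat \<Rightarrow> nat) \<Rightarrow> nat \<Rightarrow> real" where
  "prob_coalesced n \<sigma> \<tau> t = measure_pmf.prob (pairwise_law n (\<sigma>, \<tau>) t) {(\<sigma>', \<tau>'). \<sigma>' = \<tau>'}"

text \<open>The infimum in \<^typ>\<open>enat\<close> is \<open>\<infinity>\<close> if the required probability is never reached.\<close>

definition coalescence_steps :: "nat \<Rightarrow> (nat \<Rightarrow> nat) \<Rightarrow> (nat \<Rightarrow> nat) \<Rightarrow> real \<Rightarrow> enat" where
  "coalescence_steps n \<sigma> \<tau> \<epsilon> = (INF t \<in> {t. prob_coalesced n \<sigma> \<tau> t \<ge> 1 - \<epsilon>}. enat t)"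

text \<open>Each of the two copies is marginally the adjacent-transposition chain.\<close>

lemma map_pmf_fst_pairwise_step: "map_pmf fst (pairwise_step n (\<sigma>, \<tau>)) = shuffle_step n \<sigma>"
  unfolding pairwise_step_def shuffle_step_def
  by (auto simp: map_bind_pmf intro!: bind_pmf_cong)

lemma map_pmf_bernoulli_half_Not: "map_pmf Not (bernoulli_pmf (1 / 2)) = bernoulli_pmf (1 / 2)"
proof (rule pmf_eqI)
  fix b :: bool
  have "pmf (map_pmf Not (bernoulli_pmf (1 / 2))) (Not (\<not> b)) = pmf (bernoulli_pmf (1 / 2)) (\<not> b)"
    by (rule pmf_map_inj') (auto intro: injI)
  then show "pmf (map_pmf Not (bernoulli_pmf (1 / 2))) b = pmf (bernoulli_pmf (1 / 2)) b"
    by (cases b) auto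
qed

lemma map_pmf_snd_pairwise_step: "map_pmf snd (pairwise_step n (\<sigma>, \<tau>)) = shuffle_step n \<tau>"
proof -
  have flip: "bernoulli_pmf (1 / 2) \<bind> (\<lambda>b. return_pmf (if b then x else y)) =
      bernoulli_pmf (1 / 2) \<bind> (\<lambda>b. return_pmf (if b then y else x))" for x y :: "nat \<Rightarrow> nat"
  proof -
    have "bernoulli_pmf (1 / 2) \<bind> (\<lambda>b. return_pmf (if b then x else y)) =
        map_pmf Not (bernoulli_pmf (1 / 2)) \<bind> (\<lambda>b. return_pmf (if b then x else y))"
      by (simp only: map_pmf_bernoulli_half_Not)
    also have "\<dots> = bernoulli_pmf (1 / 2) \<bind> (\<lambda>b. return_pmf (if b then y else x))"
      by (auto simp: bind_map_pmf intro!: bind_pmf_cong)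
    finally show ?thesis .
  qed
  have "bernoulli_pmf (1 / 2) \<bind> (\<lambda>b. return_pmf (snd
          (if exchange_in_one_decreases n i \<sigma> \<tau>
           then (if b then (exchange i \<sigma>, \<tau>) else (\<sigma>, exchange i \<tau>))
           else (if b then (exchange i \<sigma>, exchange i \<tau>) else (\<sigma>, \<tau>))))) =
        bernoulli_pmf (1 / 2) \<bind> (\<lambda>b. return_pmf (if b then exchange i \<tau> else \<tau>))" for i
    using flip[of \<tau> "exchange i \<tau>"]
    by (cases "exchange_in_one_decreases n i \<sigma> \<tau>") (simp_all add: if_distrib[of snd] cong: if_cong)
  then show ?thesis
    unfolding pairwise_step_def shuffle_step_def by (simp add: map_bind_pmf)
qed

end

(*
  Follow one item c and let x, y be its positions in the two copies. An exchange in exactly one copy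
  decreases the Hamming distance iff it brings some item to the same position in both copies. Hence
  the order of x and y never changes, coalesced items stay together, and up to coalescence (x, y) has
  the one-step drift of two independent walkers with reflecting ends. For x < y the function
    cos (\<theta> (x + 1/2)) + cos (\<theta> (n - 1/2 - y))
  is multiplied in mean by at most 1 - (1 - cos \<theta>) / (n - 1) in one step.

  At \<theta> = \<pi> / n this is the principal eigenfunction, but it vanishes on the diagonal, and Markov's
  inequality would then lose a power of n. Taking \<theta> = (1 - \<eta>) \<pi> / n instead keeps the function above
  2 \<eta>^2. With \<eta> = 1 / ln (10 n) the rate is perturbed only by a factor 1 + o(1), and the constant
  1 / \<eta>^2 costs only an additive 2 ln (ln (10 n)) = o(ln (10 n / \<epsilon>)).
*)

theory Submission
  imports Defs "HOL-Real_Asymp.Real_Asymp"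
begin

section \<open>Exchanges, item positions and the Hamming distance\<close>

lemma exchange_permutes:
  assumes "\<sigma> permutes {..<n}" "Suc i < n"
  shows "exchange i \<sigma> permutes {..<n}"
  unfolding exchange_def using assms
  by (intro permutes_compose permutes_swap_id) auto

text \<open>Since \<open>inv \<sigma> c\<close> is the position of item \<open>c\<close>, this turns
  an exchange into a motion of that position.\<close>

lemma inv_exchange:
  assumes "bij \<sigma>"
  shows "inv (exchange i \<sigma>) c = Transposition.transpose i (Suc i) (inv \<sigma> c)"
  unfolding exchange_def using assms by (simp add: o_inv_distrib)

lemma hamming_commute: "hamming n \<sigma> \<tau> = hamming n \<tau> \<sigma>"
  unfolding hamming_def by (rule arg_cong[where f = card]) auto

lemma hamming_split:
  assumes "Suc i < n"
  shows "hamming n \<sigma> \<tau> = card {j \<in> {..<n} - {i, Suc i}. \<sigma> j \<noteq> \<tau> j}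
     + of_bool (\<sigma> i \<noteq> \<tau> i) + of_bool (\<sigma> (Suc i) \<noteq> \<tau> (Suc i))"
proof -
  have "{j \<in> {..<n}. \<sigma> j \<noteq> \<tau> j} = {j \<in> {..<n} - {i, Suc i}. \<sigma> j \<noteq> \<tau> j}
     \<union> {j \<in> {i, Suc i}. \<sigma> j \<noteq> \<tau> j}"
    using assms by auto
  then have "hamming n \<sigma> \<tau> = card {j \<in> {..<n} - {i, Suc i}. \<sigma> j \<noteq> \<tau> j}
     + card {j \<in> {i, Suc i}. \<sigma> j \<noteq> \<tau> j}"
    unfolding hamming_def by (simp only:) (intro card_Un_disjoint; auto)
  also have "{j \<in> {i, Suc i}. \<sigma> j \<noteq> \<tau> j} =
     (if \<sigma> i \<noteq> \<tau> i then {i} else {}) \<union> (if \<sigma> (Suc i) \<noteq> \<tau> (Suc i) then {Suc i} else {})"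
    by auto
  finally show ?thesis by simp
qed

text \<open>Only positions \<open>i\<close> and \<open>Suc i\<close> matter. If the exchange creates
  a match there, injectivity makes both positions mismatched beforehand, so the count drops from 2.
  If it creates none, the count afterwards is 2, the maximum.\<close>

lemma hamming_exchange_less_iff:
  assumes "inj \<sigma>" "inj \<tau>" "Suc i < n"
  shows "hamming n (exchange i \<sigma>) \<tau> < hamming n \<sigma> \<tau> \<longleftrightarrow> \<sigma> (Suc i) = \<tau> i \<or> \<sigma> i = \<tau> (Suc i)"
proof -
  have "{j \<in> {..<n} - {i, Suc i}. exchange i \<sigma> j \<noteq> \<tau> j} = {j \<in> {..<n} - {i, Suc i}. \<sigma> j \<noteq> \<tau> j}"
    by (auto simp: exchange_def Transposition.transpose_def)
  moreover have "\<sigma> i \<noteq> \<sigma> (Suc i)" "\<tau> i \<noteq> \<tau> (Suc i)"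
    using assms(1,2) by (simp_all add: inj_eq)
  ultimately show ?thesis
    using assms by (auto simp: hamming_split exchange_def)
qed

text \<open>The criterion for one copy is symmetric in the two permutations, so both disjuncts of
  the definition amount to the same condition.\<close>

lemma exchange_in_one_decreases_iff:
  assumes "inj \<sigma>" "inj \<tau>" "Suc i < n"
  shows "exchange_in_one_decreases n i \<sigma> \<tau> \<longleftrightarrow> \<sigma> (Suc i) = \<tau> i \<or> \<sigma> i = \<tau> (Suc i)"
  using hamming_exchange_less_iff[OF assms] hamming_exchange_less_iff[OF assms(2,1,3)]
  unfolding exchange_in_one_decreases_def by (auto simp: hamming_commute)

section \<open>The potential of a single item and its lower bound\<close>

text \<open>The shift by 1/2 places each reflecting wall half a unit beyond the end position: cosine
  is even, so a step across the wall leaves the value unchanged. Each cosine has its wall at the end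
  that the corresponding copy faces. The value 0 on the diagonal marks coalescence.\<close>

definition potential :: "real \<Rightarrow> nat \<Rightarrow> nat \<Rightarrow> nat \<Rightarrow> real" where
  "potential \<theta> n x y = (if x = y then 0 else
     cos (\<theta> * (real (min x y) + 1 / 2)) + cos (\<theta> * (real n - 1 / 2 - real (max x y))))"

lemma potential_commute: "potential \<theta> n x y = potential \<theta> n y x"
  by (simp add: potential_def min.commute max.commute)

lemma abs_potential_le: "\<bar>potential \<theta> n x y\<bar> \<le> 2"
proof -
  have "\<bar>cos a + cos b\<bar> \<le> 2" for a b :: real
    using abs_cos_le_one[of a] abs_cos_le_one[of b] by linarith
  then show ?thesis by (simp add: potential_def)
qed

text \<open>By the sum-to-product formula the left side is 2 cos((a+b)/2) cos((a-b)/2). Both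
  half-angles are at most \<open>(1 - \<eta>) * pi / 2\<close> in absolute value, so each factor is
  at least \<eta>.\<close>

lemma cos_add_cos_ge:
  fixes \<theta> \<eta> x y :: real
  assumes "\<theta> * real n = (1 - \<eta>) * pi" "0 \<le> \<eta>" "\<eta> \<le> 1" "0 \<le> x" "x \<le> y" "y \<le> real n" "n > 0"
  shows "cos (\<theta> * x) + cos (\<theta> * (real n - y)) \<ge> 2 * \<eta>\<^sup>2"
proof -
  define a where "a = \<theta> * x"
  define b where "b = \<theta> * (real n - y)"
  have \<theta>: "\<theta> \<ge> 0"
    using assms by (metis mult_nonneg_nonneg diff_ge_0_iff_ge pi_ge_zero zero_le_mult_iff
        of_nat_0_less_iff linorder_not_le)
  have ab: "a \<ge> 0" "b \<ge> 0" "a + b \<le> (1 - \<eta>) * pi"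
    using \<theta> assms mult_left_mono[OF \<open>x \<le> y\<close> \<theta>] by (auto simp: a_def b_def algebra_simps intro!: mult_left_mono)
  have "\<eta> \<le> sin (\<eta> * (pi / 2))"
  proof -
    \<comment> \<open>Sine lies above its chord from 0 to \<open>pi / 2\<close>, whose value at
      \<open>\<eta> * (pi / 2)\<close> is \<eta>.\<close>
    have "concave_on {0..pi} sin"
      by (rule f''_le0_imp_concave[where f' = cos and f'' = "\<lambda>x. - sin x"])
         (auto intro!: derivative_eq_intros sin_ge_zero)
    from concave_onD[OF this, of \<eta> 0 "pi/2"] assms show ?thesis by simp
  qed
  also have "sin (\<eta> * (pi / 2)) = cos ((1 - \<eta>) * pi / 2)"
    by (subst cos_sin_eq) (simp add: field_simps)
  finally have c: "\<eta> \<le> cos ((1 - \<eta>) * pi / 2)" .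
  have \<eta>pi: "0 \<le> (1 - \<eta>) * pi" "(1 - \<eta>) * pi \<le> pi"
    using assms by (auto intro!: mult_left_le_one_le)
  have "cos ((1 - \<eta>) * pi / 2) \<le> cos ((a + b) / 2)"
    using ab \<eta>pi by (intro cos_monotone_0_pi_le) auto
  moreover have "\<bar>a - b\<bar> \<le> (1 - \<eta>) * pi"
    using ab by (intro abs_leI) linarith+
  then have "cos ((1 - \<eta>) * pi / 2) \<le> cos (\<bar>a - b\<bar> / 2)"
    using \<eta>pi by (intro cos_monotone_0_pi_le) auto
  ultimately have "\<eta> * \<eta> \<le> cos ((a + b) / 2) * cos ((a - b) / 2)"
    using c assms cos_abs_real[of "(a - b) / 2"] by (intro mult_mono) auto
  then show ?thesis
    unfolding a_def[symmetric] b_def[symmetric] cos_plus_cos by (simp add: power2_eq_square)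
qed

lemma potential_ge:
  assumes "\<theta> * real n = (1 - \<eta>) * pi" "0 \<le> \<eta>" "\<eta> \<le> 1" "x < n" "y < n" "x \<noteq> y"
  shows "potential \<theta> n x y \<ge> 2 * \<eta>\<^sup>2"
proof -
  have "2 * \<eta>\<^sup>2 \<le> cos (\<theta> * (real (min x y) + 1 / 2)) + cos (\<theta> * (real n - (real (max x y) + 1 / 2)))"
    using assms by (intro cos_add_cos_ge) auto
  then show ?thesis
    using assms(6) by (simp add: potential_def diff_diff_eq add.commute)
qed

section \<open>One-step drift of a single item\<close>

lemma cos_second_difference:
  "cos (\<theta> * (x + 1)) + cos (\<theta> * (x - 1)) = 2 * cos \<theta> * cos (\<theta> * x)" for x \<theta> :: real
  by (simp add: distrib_left right_diff_distrib cos_add cos_diff)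

text \<open>Only the exchanges \<open>i = x\<close> and \<open>i = x - 1\<close> move position
  \<open>x\<close>, so the sum is the discrete Laplacian with reflection at both ends.\<close>

lemma sum_transpose_adjacent:
  fixes g :: "nat \<Rightarrow> real"
  assumes "x < n"
  shows "(\<Sum>i<n - 1. g (Transposition.transpose i (Suc i) x) - g x) =
    (if Suc x < n then g (Suc x) - g x else 0) + (if x > 0 then g (x - 1) - g x else 0)"
proof -
  have "(\<Sum>i<n - 1. g (Transposition.transpose i (Suc i) x) - g x) =
    (\<Sum>i<n - 1. (if i = x then g (Suc x) - g x else 0)
       + (if x > 0 \<and> i = x - 1 then g (x - 1) - g x else 0))"
    by (intro sum.cong) (auto simp: Transposition.transpose_def)
  also have "\<dots> = (if Suc x < n then g (Suc x) - g x else 0)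
       + (if x > 0 then g (x - 1) - g x else 0)"
    using assms by (cases "x > 0") (auto simp: sum.distrib)
  finally show ?thesis .
qed

lemma potential_less:
  "x < y \<Longrightarrow> potential \<theta> n x y =
     cos (\<theta> * (real x + 1 / 2)) + cos (\<theta> * (real n - 1 / 2 - real y))"
  by (simp add: potential_def)

text \<open>An exchange in one copy can bring the item onto the diagonal, where the potential drops
  to 0. The cosine formula is still nonnegative there, so it bounds the potential in either
  case.\<close>

lemma potential_le:
  assumes "\<theta> * real n = (1 - \<eta>) * pi" "0 \<le> \<eta>" "\<eta> \<le> 1" "x \<le> y" "y < n"
  shows "potential \<theta> n x y \<le> cos (\<theta> * (real x + 1 / 2)) + cos (\<theta> * (real n - 1 / 2 - real y))"
proof (cases "x = y")
  case True
  have "0 \<le> 2 * \<eta>\<^sup>2" by simp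
  also have "\<dots> \<le> cos (\<theta> * (real x + 1 / 2)) + cos (\<theta> * (real n - (real x + 1 / 2)))"
    using assms True by (intro cos_add_cos_ge) auto
  finally show ?thesis using True by (simp add: potential_def algebra_simps)
qed (use assms in \<open>simp add: potential_less\<close>)

text \<open>The cosine is an eigenfunction of the Laplacian. At \<open>x = 0\<close> the missing
  neighbour would have the value cos(-\<theta>/2), equal to that at 0. The far end is excluded by
  \<open>Suc x < n\<close>, which holds for the left one of two distinct positions.\<close>

lemma sum_cos_left:
  fixes \<theta> :: real
  assumes "Suc x < n"
  defines "g \<equiv> \<lambda>k::nat. cos (\<theta> * (real k + 1 / 2))"
  shows "(\<Sum>i<n - 1. g (Transposition.transpose i (Suc i) x) - g x) = - 2 * (1 - cos \<theta>) * g x"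
proof -
  have "g (Suc x) - g x + (if x > 0 then g (x - 1) - g x else 0) = - 2 * (1 - cos \<theta>) * g x"
  proof (cases x)
    case 0
    show ?thesis using cos_second_difference[of \<theta> "1/2"]
      by (simp add: 0 g_def algebra_simps)
  next
    case (Suc k)
    show ?thesis using cos_second_difference[of \<theta> "real x + 1/2"]
      by (simp add: Suc g_def algebra_simps)
  qed
  then show ?thesis
    using assms by (subst sum_transpose_adjacent) auto
qed

text \<open>The mirror image of \<open>sum_cos_left\<close>, with the reflecting wall beyond
  position \<open>n - 1\<close>.\<close>

lemma sum_cos_right:
  fixes \<theta> :: real
  assumes "0 < y" "y < n"
  defines "h \<equiv> \<lambda>k::nat. cos (\<theta> * (real n - 1 / 2 - real k))"
  shows "(\<Sum>i<n - 1. h (Transposition.transpose i (Suc i) y) - h y) = - 2 * (1 - cos \<theta>) * h y"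
proof -
  obtain k where k: "y = Suc k" using assms(1) by (cases y) auto
  have "(if Suc y < n then h (Suc y) - h y else 0) + (h (y - 1) - h y) = - 2 * (1 - cos \<theta>) * h y"
  proof (cases "Suc y < n")
    case False
    then have "real n = real y + 1" using assms by simp
    then show ?thesis using cos_second_difference[of \<theta> "1/2"]
      by (simp add: k h_def algebra_simps)
  next
    case True
    show ?thesis using True cos_second_difference[of \<theta> "real n - 1/2 - real y"]
      by (simp add: k h_def algebra_simps)
  qed
  then show ?thesis
    using assms by (subst sum_transpose_adjacent) auto
qed

text \<open>The cosine formula is a sum of a function of \<open>x\<close> and a function of
  \<open>y\<close>. Hence moving one copy in each of the two coin outcomes, or both copies in one
  outcome, adds the same total increment, and the two eigenfunction identities apply.
  \<open>D i\<close> may also hold because of another item; it is forced only where a joint exchange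
  would make \<open>x\<close> and \<open>y\<close> cross.\<close>

lemma potential_drift_less:
  assumes \<theta>: "\<theta> * real n = (1 - \<eta>) * pi" "0 \<le> \<eta>" "\<eta> \<le> 1"
    and xy: "x < y" "y < n"
    and D: "\<And>i. x = i \<Longrightarrow> y = Suc i \<Longrightarrow> D i"
  defines "s \<equiv> \<lambda>i. Transposition.transpose i (Suc i)"
  shows "(\<Sum>i<n - 1. if D i then potential \<theta> n (s i x) y + potential \<theta> n x (s i y)
            else potential \<theta> n (s i x) (s i y) + potential \<theta> n x y)
         \<le> 2 * (real (n - 1) - (1 - cos \<theta>)) * potential \<theta> n x y"
proof -
  define g where "g = (\<lambda>k::nat. cos (\<theta> * (real k + 1 / 2)))"
  define h where "h = (\<lambda>k::nat. cos (\<theta> * (real n - 1 / 2 - real k)))"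
  have V: "potential \<theta> n x y = g x + h y"
    using xy by (simp add: potential_less g_def h_def)
  have "(\<Sum>i<n - 1. if D i then potential \<theta> n (s i x) y + potential \<theta> n x (s i y)
            else potential \<theta> n (s i x) (s i y) + potential \<theta> n x y)
      \<le> (\<Sum>i<n - 1. 2 * (g x + h y) + (g (s i x) - g x) + (h (s i y) - h y))"
  proof (rule sum_mono)
    fix i assume i: "i \<in> {..<n - 1}"
    show "(if D i then potential \<theta> n (s i x) y + potential \<theta> n x (s i y)
            else potential \<theta> n (s i x) (s i y) + potential \<theta> n x y)
        \<le> 2 * (g x + h y) + (g (s i x) - g x) + (h (s i y) - h y)"
    proof (cases "D i")
      case True
      have "potential \<theta> n (s i x) y \<le> g (s i x) + h y"
        unfolding g_def h_def using xy by (intro potential_le[OF \<theta>]) (auto simp: s_def Transposition.transpose_def)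
      moreover have "potential \<theta> n x (s i y) \<le> g x + h (s i y)"
        unfolding g_def h_def using xy i by (intro potential_le[OF \<theta>]) (auto simp: s_def Transposition.transpose_def)
      ultimately show ?thesis using True by simp
    next
      case False
      \<comment> \<open>A joint exchange reverses the order only for \<open>x = i\<close> and
        \<open>y = Suc i\<close>, where \<open>D i\<close> would hold.\<close>
      then have "s i x < s i y"
        using xy D by (auto simp: s_def Transposition.transpose_def)
      then have "potential \<theta> n (s i x) (s i y) = g (s i x) + h (s i y)"
        by (simp add: potential_less g_def h_def)
      then show ?thesis using False V by simp
    qed
  qed
  also have "\<dots> = 2 * real (n - 1) * (g x + h y) + (\<Sum>i<n - 1. g (s i x) - g x)
      + (\<Sum>i<n - 1. h (s i y) - h y)"
    by (simp only: sum.distrib sum_constant) simp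
  also have "\<dots> = 2 * real (n - 1) * (g x + h y) - 2 * (1 - cos \<theta>) * g x - 2 * (1 - cos \<theta>) * h y"
    using sum_cos_left[of x n \<theta>] sum_cos_right[of y n \<theta>] xy
    unfolding s_def g_def h_def by (simp add: left_diff_distrib)
  finally show ?thesis unfolding V by (simp add: algebra_simps)
qed

text \<open>The case \<open>x > y\<close> follows by symmetry. On the diagonal, \<open>D'\<close>
  prevents a one-copy exchange from moving the coalesced item, so every summand is 0.\<close>

lemma potential_drift:
  assumes \<theta>: "\<theta> * real n = (1 - \<eta>) * pi" "0 \<le> \<eta>" "\<eta> \<le> 1"
    and xy: "x < n" "y < n"
    and D: "\<And>i. Suc i < n \<Longrightarrow> x = i \<and> y = Suc i \<or> y = i \<and> x = Suc i \<Longrightarrow> D i"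
    and D': "\<And>i. Suc i < n \<Longrightarrow> D i \<Longrightarrow> x = y \<Longrightarrow> x \<noteq> i \<and> x \<noteq> Suc i"
  defines "s \<equiv> \<lambda>i. Transposition.transpose i (Suc i)"
  shows "(\<Sum>i<n - 1. if D i then potential \<theta> n (s i x) y + potential \<theta> n x (s i y)
            else potential \<theta> n (s i x) (s i y) + potential \<theta> n x y)
         \<le> 2 * (real (n - 1) - (1 - cos \<theta>)) * potential \<theta> n x y"
proof (cases x y rule: linorder_cases)
  case less
  then show ?thesis
    unfolding s_def using xy D by (intro potential_drift_less[OF \<theta>]) auto
next
  case equal
  have "s i x = x" if "D i" "Suc i < n" for i
    using D'[OF that(2,1)] equal by (auto simp: s_def)
  then show ?thesis
    using equal by (auto simp: potential_def intro!: sum_nonpos)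
next
  case greater
  then have "(\<Sum>i<n - 1. if D i then potential \<theta> n (s i y) x + potential \<theta> n y (s i x)
            else potential \<theta> n (s i y) (s i x) + potential \<theta> n y x)
         \<le> 2 * (real (n - 1) - (1 - cos \<theta>)) * potential \<theta> n y x"
    unfolding s_def using xy D by (intro potential_drift_less[OF \<theta>]) auto
  then show ?thesis
    by (simp only: potential_commute add.commute)
qed

section \<open>The total potential and the support of the coupling\<close>

definition total_potential :: "real \<Rightarrow> nat \<Rightarrow> (nat \<Rightarrow> nat) \<times> (nat \<Rightarrow> nat) \<Rightarrow> real" where
  "total_potential \<theta> n = (\<lambda>(\<sigma>, \<tau>). \<Sum>c<n. potential \<theta> n (inv \<sigma> c) (inv \<tau> c))"

lemma set_pmf_pairwise_step:
  assumes "n \<ge> 2"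
  shows "set_pmf (pairwise_step n (\<sigma>, \<tau>)) \<subseteq>
    (\<Union>i<n - 1. {(exchange i \<sigma>, \<tau>), (\<sigma>, exchange i \<tau>), (exchange i \<sigma>, exchange i \<tau>), (\<sigma>, \<tau>)})"
proof -
  have S: "set_pmf (pmf_of_set {..<n - 1}) = {..<n - 1}"
    using assms by (intro set_pmf_of_set) (auto simp: lessThan_empty_iff)
  then show ?thesis
    unfolding pairwise_step_def prod.case set_bind_pmf S
    by (intro UN_mono[OF order_refl] UN_least) simp
qed

text \<open>Finite support makes the later expectations finite sums and settles
  integrability.\<close>

lemma finite_set_pairwise_step: "n \<ge> 2 \<Longrightarrow> finite (set_pmf (pairwise_step n p))"
  using set_pmf_pairwise_step[of n "fst p" "snd p"] by (auto intro: finite_subset)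

lemma finite_set_pairwise_law: "n \<ge> 2 \<Longrightarrow> finite (set_pmf (pairwise_law n p t))"
  by (induction t) (auto intro: finite_set_pairwise_step)

lemma set_pmf_pairwise_law:
  assumes "n \<ge> 2" "\<sigma> permutes {..<n}" "\<tau> permutes {..<n}" "q \<in> set_pmf (pairwise_law n (\<sigma>, \<tau>) t)"
  shows "fst q permutes {..<n} \<and> snd q permutes {..<n}"
  using assms(4)
proof (induction t arbitrary: q)
  case 0
  then show ?case using assms by simp
next
  case (Suc t)
  then obtain p where p: "p \<in> set_pmf (pairwise_law n (\<sigma>, \<tau>) t)" "q \<in> set_pmf (pairwise_step n p)"
    by auto
  obtain i where "i < n - 1" and q: "q \<in> {(exchange i (fst p), snd p), (fst p, exchange i (snd p)),
      (exchange i (fst p), exchange i (snd p)), p}"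
    using set_pmf_pairwise_step[OF assms(1), of "fst p" "snd p"] p(2)
    unfolding prod.collapse by blast
  then have "Suc i < n" by simp
  then show ?case using q Suc.IH[OF p(1)] by (auto intro: exchange_permutes)
qed

section \<open>Geometric decay of the expected total potential\<close>

lemma expectation_pairwise_step:
  fixes f :: "(nat \<Rightarrow> nat) \<times> (nat \<Rightarrow> nat) \<Rightarrow> real"
  assumes "n \<ge> 2"
  shows "measure_pmf.expectation (pairwise_step n (\<sigma>, \<tau>)) f =
    (\<Sum>i<n - 1. if exchange_in_one_decreases n i \<sigma> \<tau>
       then f (exchange i \<sigma>, \<tau>) + f (\<sigma>, exchange i \<tau>)
       else f (exchange i \<sigma>, exchange i \<tau>) + f (\<sigma>, \<tau>)) / (2 * real (n - 1))"
proof -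
  have b: "measure_pmf.expectation (bernoulli_pmf (1/2) \<bind> (\<lambda>b. return_pmf (k b))) f
      = (f (k True) + f (k False)) / 2" for k
    by (subst pmf_expectation_bind[of UNIV]) (auto simp: UNIV_bool)
  have step: "measure_pmf.expectation (bernoulli_pmf (1/2) \<bind> (\<lambda>b. return_pmf
         (if exchange_in_one_decreases n i \<sigma> \<tau>
          then (if b then (exchange i \<sigma>, \<tau>) else (\<sigma>, exchange i \<tau>))
          else (if b then (exchange i \<sigma>, exchange i \<tau>) else (\<sigma>, \<tau>))))) f =
      (if exchange_in_one_decreases n i \<sigma> \<tau>
       then f (exchange i \<sigma>, \<tau>) + f (\<sigma>, exchange i \<tau>)
       else f (exchange i \<sigma>, exchange i \<tau>) + f (\<sigma>, \<tau>)) / 2" for i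
    by (cases "exchange_in_one_decreases n i \<sigma> \<tau>") (simp_all add: b)
  obtain N where N: "n - 1 = N" "N > 0" using assms by simp
  have scale: "(x / 2) /\<^sub>R real (card {..<N}) = x / (2 * real N)" for x :: real
    by (simp add: field_simps)
  have "{..<N} \<noteq> {}" using N by (simp add: lessThan_empty_iff)
  then show ?thesis
    unfolding pairwise_step_def N(1) prod.case
    by (subst pmf_expectation_bind_pmf_of_set)
       (simp_all only: step sum_divide_distrib scale finite_lessThan, simp_all)
qed

text \<open>Interchanging the sums over items and exchanges reduces the claim to
  \<open>potential_drift\<close> for each item.\<close>

lemma expectation_total_potential_step:
  assumes \<theta>: "\<theta> * real n = (1 - \<eta>) * pi" "0 \<le> \<eta>" "\<eta> \<le> 1"
    and n: "n \<ge> 2" and perm: "\<sigma> permutes {..<n}" "\<tau> permutes {..<n}"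
  shows "measure_pmf.expectation (pairwise_step n (\<sigma>, \<tau>)) (total_potential \<theta> n)
    \<le> (1 - (1 - cos \<theta>) / real (n - 1)) * total_potential \<theta> n (\<sigma>, \<tau>)"
proof -
  let ?s = "\<lambda>i. Transposition.transpose i (Suc i)"
  have inj: "inj \<sigma>" "inj \<tau>" and bij: "bij \<sigma>" "bij \<tau>"
    using perm by (auto simp: permutes_inj permutes_bij)
  note D = exchange_in_one_decreases_iff[OF inj]
  have "(\<Sum>i<n - 1. if exchange_in_one_decreases n i \<sigma> \<tau>
       then total_potential \<theta> n (exchange i \<sigma>, \<tau>) + total_potential \<theta> n (\<sigma>, exchange i \<tau>)
       else total_potential \<theta> n (exchange i \<sigma>, exchange i \<tau>) + total_potential \<theta> n (\<sigma>, \<tau>))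
     = (\<Sum>c<n. \<Sum>i<n - 1. if exchange_in_one_decreases n i \<sigma> \<tau>
         then potential \<theta> n (?s i (inv \<sigma> c)) (inv \<tau> c) + potential \<theta> n (inv \<sigma> c) (?s i (inv \<tau> c))
         else potential \<theta> n (?s i (inv \<sigma> c)) (?s i (inv \<tau> c)) + potential \<theta> n (inv \<sigma> c) (inv \<tau> c))"
    by (subst sum.swap) (auto simp: total_potential_def inv_exchange bij sum.distrib intro!: sum.cong)
  also have "\<dots> \<le> (\<Sum>c<n. 2 * (real (n - 1) - (1 - cos \<theta>)) * potential \<theta> n (inv \<sigma> c) (inv \<tau> c))"
  proof (rule sum_mono)
    fix c assume "c \<in> {..<n}"
    then have lt: "inv \<sigma> c < n" "inv \<tau> c < n"
      using perm permutes_in_image[OF permutes_inv] by (metis lessThan_iff)+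
    have inv: "\<sigma> (inv \<sigma> c) = c" "\<tau> (inv \<tau> c) = c"
      using perm by (simp_all add: permutes_inverses)
    show "(\<Sum>i<n - 1. if exchange_in_one_decreases n i \<sigma> \<tau>
         then potential \<theta> n (?s i (inv \<sigma> c)) (inv \<tau> c) + potential \<theta> n (inv \<sigma> c) (?s i (inv \<tau> c))
         else potential \<theta> n (?s i (inv \<sigma> c)) (?s i (inv \<tau> c)) + potential \<theta> n (inv \<sigma> c) (inv \<tau> c))
      \<le> 2 * (real (n - 1) - (1 - cos \<theta>)) * potential \<theta> n (inv \<sigma> c) (inv \<tau> c)"
    proof (rule potential_drift[OF \<theta> lt])
      fix i assume i: "Suc i < n"
      \<comment> \<open>Item \<open>c\<close> sits at \<open>i\<close> in one copy and at
        \<open>Suc i\<close> in the other, so exchanging in one copy matches it.\<close>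
      show "exchange_in_one_decreases n i \<sigma> \<tau>"
        if "inv \<sigma> c = i \<and> inv \<tau> c = Suc i \<or> inv \<tau> c = i \<and> inv \<sigma> c = Suc i"
        using that inv D[OF i] by auto
      \<comment> \<open>If both copies had \<open>c\<close> at \<open>i\<close> or both at
        \<open>Suc i\<close>, the match created by the exchange would give one copy the same item at
        both positions.\<close>
      show "inv \<sigma> c \<noteq> i \<and> inv \<sigma> c \<noteq> Suc i"
        if "exchange_in_one_decreases n i \<sigma> \<tau>" "inv \<sigma> c = inv \<tau> c"
        using that inv D[OF i] inj by (metis injD n_not_Suc_n)
    qed
  qed
  also have "\<dots> = 2 * (real (n - 1) - (1 - cos \<theta>)) * total_potential \<theta> n (\<sigma>, \<tau>)"
    by (simp add: total_potential_def sum_distrib_left)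
  finally have "measure_pmf.expectation (pairwise_step n (\<sigma>, \<tau>)) (total_potential \<theta> n)
      \<le> 2 * (real (n - 1) - (1 - cos \<theta>)) * total_potential \<theta> n (\<sigma>, \<tau>) / (2 * real (n - 1))"
    unfolding expectation_pairwise_step[OF n] by (rule divide_right_mono) simp
  also have "\<dots> = (1 - (1 - cos \<theta>) / real (n - 1)) * total_potential \<theta> n (\<sigma>, \<tau>)"
  proof -
    have "real (n - 1) \<noteq> 0" using n by simp
    then show ?thesis by (simp add: field_simps del: of_nat_diff)
  qed
  finally show ?thesis .
qed

lemma expectation_total_potential_law:
  assumes \<theta>: "\<theta> * real n = (1 - \<eta>) * pi" "0 \<le> \<eta>" "\<eta> \<le> 1"
    and n: "n \<ge> 2" and perm: "\<sigma> permutes {..<n}" "\<tau> permutes {..<n}"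
    and \<mu>: "\<mu> = 1 - (1 - cos \<theta>) / real (n - 1)" "\<mu> \<ge> 0"
  shows "measure_pmf.expectation (pairwise_law n (\<sigma>, \<tau>) t) (total_potential \<theta> n)
    \<le> \<mu> ^ t * total_potential \<theta> n (\<sigma>, \<tau>)"
proof (induction t)
  case (Suc t)
  let ?L = "pairwise_law n (\<sigma>, \<tau>) t"
  have "measure_pmf.expectation (pairwise_law n (\<sigma>, \<tau>) (Suc t)) (total_potential \<theta> n)
      = (\<Sum>p\<in>set_pmf ?L. pmf ?L p *\<^sub>R measure_pmf.expectation (pairwise_step n p) (total_potential \<theta> n))"
    unfolding pairwise_law.simps using n by (intro pmf_expectation_bind) (auto intro: finite_set_pairwise_law finite_set_pairwise_step)
  also have "\<dots> \<le> (\<Sum>p\<in>set_pmf ?L. pmf ?L p *\<^sub>R (\<mu> * total_potential \<theta> n p))"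
  proof (intro sum_mono scaleR_left_mono)
    fix p assume "p \<in> set_pmf ?L"
    then show "measure_pmf.expectation (pairwise_step n p) (total_potential \<theta> n) \<le> \<mu> * total_potential \<theta> n p"
      using expectation_total_potential_step[OF \<theta> n, of "fst p" "snd p"]
        set_pmf_pairwise_law[OF n perm] unfolding \<mu> by auto
  qed auto
  also have "\<dots> = \<mu> * measure_pmf.expectation ?L (total_potential \<theta> n)"
    using finite_set_pairwise_law[OF n]
    by (subst integral_measure_pmf[of "set_pmf ?L"])
       (auto simp: sum_distrib_left algebra_simps set_pmf_iff)
  also have "\<dots> \<le> \<mu> * (\<mu> ^ t * total_potential \<theta> n (\<sigma>, \<tau>))"
    using Suc.IH \<mu> by (intro mult_left_mono) auto
  finally show ?case by (simp add: mult.assoc)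
qed simp

section \<open>From the total potential to the probability of coalescence\<close>

lemma total_potential_le: "total_potential \<theta> n p \<le> 2 * real n"
proof -
  have "total_potential \<theta> n p \<le> (\<Sum>c<n. 2)"
    unfolding total_potential_def case_prod_beta
    by (intro sum_mono) (use abs_potential_le abs_le_D1 in blast)
  then show ?thesis by simp
qed

text \<open>Distinct permutations place some item differently; that item alone contributes
  \<open>2 * \<eta>\<^sup>2\<close>, and no item contributes a negative amount.\<close>

lemma total_potential_ge:
  assumes \<theta>: "\<theta> * real n = (1 - \<eta>) * pi" "0 \<le> \<eta>" "\<eta> \<le> 1"
    and perm: "\<sigma> permutes {..<n}" "\<tau> permutes {..<n}"
  shows "2 * \<eta>\<^sup>2 * of_bool (\<sigma> \<noteq> \<tau>) \<le> total_potential \<theta> n (\<sigma>, \<tau>)"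
proof -
  have lt: "inv \<sigma> c < n" "inv \<tau> c < n" if "c < n" for c
    using that perm permutes_in_image[OF permutes_inv] by (metis lessThan_iff)+
  have ge: "2 * \<eta>\<^sup>2 * of_bool (inv \<sigma> c \<noteq> inv \<tau> c) \<le> potential \<theta> n (inv \<sigma> c) (inv \<tau> c)" if "c < n" for c
    using potential_ge[OF \<theta> lt[OF that]] by (auto simp: potential_def)
  have nonneg: "potential \<theta> n (inv \<sigma> c) (inv \<tau> c) \<ge> 0" if "c < n" for c
    using ge[OF that] by (smt (verit) mult_nonneg_nonneg of_bool_eq zero_le_power2)
  show ?thesis
  proof (cases "\<sigma> = \<tau>")
    case False
    have "\<exists>c<n. inv \<sigma> c \<noteq> inv \<tau> c"
    proof (rule ccontr)
      assume "\<not> (\<exists>c<n. inv \<sigma> c \<noteq> inv \<tau> c)"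
      then have "inv \<sigma> c = inv \<tau> c" for c
        using permutes_not_in[OF permutes_inv] perm by (metis lessThan_iff)
      then show False
        using False perm by (metis ext permutes_inv_inv)
    qed
    then obtain c where c: "c < n" "inv \<sigma> c \<noteq> inv \<tau> c" by blast
    then have "2 * \<eta>\<^sup>2 \<le> potential \<theta> n (inv \<sigma> c) (inv \<tau> c)" using ge by fastforce
    also have "\<dots> \<le> total_potential \<theta> n (\<sigma>, \<tau>)"
      unfolding total_potential_def prod.case
      using c nonneg by (intro member_le_sum) auto
    finally show ?thesis using False by simp
  qed (simp add: total_potential_def potential_def)
qed

text \<open>Markov's inequality: the expected potential is at most \<open>2 * real n\<close> times
  the decay factor, and at least \<open>2 * \<eta>\<^sup>2\<close> times the probability of not
  having coalesced.\<close>

lemma prob_coalesced_ge: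
  assumes \<theta>: "\<theta> * real n = (1 - \<eta>) * pi" "0 < \<eta>" "\<eta> \<le> 1"
    and n: "n \<ge> 2" and perm: "\<sigma> permutes {..<n}" "\<tau> permutes {..<n}"
  shows "prob_coalesced n \<sigma> \<tau> t \<ge> 1 - real n / \<eta>\<^sup>2 * exp (- real t * ((1 - cos \<theta>) / real (n - 1)))"
proof -
  define \<mu> where "\<mu> = 1 - (1 - cos \<theta>) / real (n - 1)"
  have "\<theta> = (1 - \<eta>) * pi / real n" using \<theta> n by (simp add: field_simps)
  \<comment> \<open>As \<open>n \<ge> 2\<close>, the angle is at most \<open>pi / 2\<close>; its
    cosine is then nonnegative, which makes \<mu> nonnegative.\<close>
  moreover have "(1 - \<eta>) * pi / real n \<le> 1 * pi / 2"
    using n \<theta> by (intro frac_le mult_right_mono) auto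
  moreover have "0 \<le> (1 - \<eta>) * pi / real n" using \<theta> by simp
  ultimately have "cos \<theta> \<ge> 0"
    using pi_ge_zero by (intro cos_ge_zero) linarith+
  then have \<mu>: "\<mu> \<ge> 0" using n by (simp add: \<mu>_def field_simps)
  let ?L = "pairwise_law n (\<sigma>, \<tau>) t"
  let ?E = "{(\<sigma>'::nat \<Rightarrow> nat, \<tau>'). \<sigma>' = \<tau>'}"
  have fin: "finite (set_pmf ?L)" using finite_set_pairwise_law[OF n] .
  have "2 * \<eta>\<^sup>2 * measure_pmf.prob ?L (- ?E) = measure_pmf.expectation ?L (\<lambda>p. 2 * \<eta>\<^sup>2 * indicator (- ?E) p)"
    by simp
  also have "\<dots> \<le> measure_pmf.expectation ?L (total_potential \<theta> n)"
  proof (rule integral_mono_AE)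
    show "AE p in ?L. 2 * \<eta>\<^sup>2 * indicator (- ?E) p \<le> total_potential \<theta> n p"
    proof (rule AE_pmfI)
      fix p assume "p \<in> set_pmf ?L"
      then show "2 * \<eta>\<^sup>2 * indicator (- ?E) p \<le> total_potential \<theta> n p"
        using total_potential_ge[OF \<theta>(1) less_imp_le[OF \<theta>(2)] \<theta>(3), of "fst p" "snd p"]
          set_pmf_pairwise_law[OF n perm]
        by (cases p) (auto simp: indicator_def of_bool_def split: if_splits)
    qed
  qed (auto intro: integrable_measure_pmf_finite[OF fin])
  also have "\<dots> \<le> \<mu> ^ t * total_potential \<theta> n (\<sigma>, \<tau>)"
    using \<theta> n perm \<mu> by (intro expectation_total_potential_law[of _ _ \<eta>]) (auto simp: \<mu>_def)
  also have "\<dots> \<le> exp (- ((1 - cos \<theta>) / real (n - 1))) ^ t * (2 * real n)"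
  proof (intro mult_mono power_mono)
    show "\<mu> \<le> exp (- ((1 - cos \<theta>) / real (n - 1)))"
      using exp_ge_add_one_self[of "- ((1 - cos \<theta>) / real (n - 1))"] by (simp add: \<mu>_def)
    show "0 \<le> total_potential \<theta> n (\<sigma>, \<tau>)"
      using total_potential_ge[OF \<theta>(1) less_imp_le[OF \<theta>(2)] \<theta>(3) perm]
      by (smt (verit) mult_nonneg_nonneg of_bool_def zero_le_power2)
  qed (use \<mu> total_potential_le in auto)
  also have "exp (- ((1 - cos \<theta>) / real (n - 1))) ^ t = exp (- real t * ((1 - cos \<theta>) / real (n - 1)))"
    by (simp flip: exp_of_nat_mult)
  finally have "measure_pmf.prob ?L (- ?E) \<le> real n / \<eta>\<^sup>2 * exp (- real t * ((1 - cos \<theta>) / real (n - 1)))"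
    using \<theta> by (simp add: field_simps)
  moreover have "measure_pmf.prob ?L (- ?E) = 1 - prob_coalesced n \<sigma> \<tau> t"
    using measure_pmf.prob_compl[of ?E ?L] by (simp add: prob_coalesced_def Compl_eq_Diff_UNIV)
  ultimately show ?thesis by simp
qed

section \<open>Asymptotics of the constant and the final bound\<close>

text \<open>The angle is asymptotic to \<open>pi / n\<close>, so 1 - cos is asymptotic to
  \<open>pi\<^sup>2 / (2 * n\<^sup>2)\<close> and the first quotient tends to
  \<open>2 / pi\<^sup>2\<close>; the correction factor tends to 1.\<close>

lemma rate_constant_tendsto:
  "(\<lambda>n::nat. real (n - 1) / ((1 - cos ((1 - 1 / ln (10 * real n)) * pi / real n)) * real n ^ 3)
     * (1 + 2 * ln (ln (10 * real n)) / ln (10 * real n)) + 1 / real n ^ 3 - 2 / pi\<^sup>2) \<longlonglongrightarrow> 0"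
proof -
  have "(\<lambda>n::nat. (real n - 1) / ((1 - cos ((1 - 1 / ln (10 * real n)) * pi / real n)) * real n ^ 3)
     * (1 + 2 * ln (ln (10 * real n)) / ln (10 * real n)) + 1 / real n ^ 3 - 2 / pi\<^sup>2) \<longlonglongrightarrow> 0"
    by (real_asymp simp: field_simps power2_eq_square)
  moreover have "\<forall>\<^sub>F n in sequentially. real (n - 1) = real n - 1"
    using eventually_ge_at_top[of 1] by eventually_elim (simp add: of_nat_diff)
  ultimately show ?thesis
    by (elim Lim_transform_eventually) (elim eventually_mono, simp)
qed

text \<open>Ensures that \<open>\<eta> = 1 / ln (10 * real n)\<close> lies strictly between 0 and 1
  and that the iterated logarithm is positive.\<close>

lemma ln_ten_mult_ge_1:
  assumes "n \<ge> 1"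
  shows "ln (10 * real n) > 1"
proof -
  have "exp 1 < 10 * real n" using exp_le assms by linarith
  then have "ln (exp 1) < ln (10 * real n)" using assms by (subst ln_less_cancel_iff) auto
  then show ?thesis by simp
qed

theorem theorem10:
  "\<exists>\<delta> :: nat \<Rightarrow> real. \<delta> \<longlonglongrightarrow> 0 \<and>
     (\<forall>n \<ge> 2. \<forall>\<epsilon> \<in> {0<..<1}. \<forall>\<sigma> \<tau>.
        \<sigma> permutes {..<n} \<longrightarrow> \<tau> permutes {..<n} \<longrightarrow>
        ereal_of_enat (coalescence_steps n \<sigma> \<tau> \<epsilon>)
          \<le> ereal ((2 / pi\<^sup>2 + \<delta> n) * real n ^ 3 * ln (10 * real n / \<epsilon>)))"
proof -
  define \<theta> where "\<theta> = (\<lambda>n. (1 - 1 / ln (10 * real n)) * pi / real n)"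
  \<comment> \<open>Chosen so that \<open>2 / pi\<^sup>2 + \<delta> n\<close> is exactly the
    coefficient obtained below; \<open>1 / real n ^ 3\<close> pays for rounding the time up.\<close>
  define \<delta> where "\<delta> = (\<lambda>n. real (n - 1) / ((1 - cos (\<theta> n)) * real n ^ 3)
     * (1 + 2 * ln (ln (10 * real n)) / ln (10 * real n)) + 1 / real n ^ 3 - 2 / pi\<^sup>2)"
  have "\<delta> \<longlonglongrightarrow> 0"
    unfolding \<delta>_def \<theta>_def by (rule rate_constant_tendsto)
  moreover have "ereal_of_enat (coalescence_steps n \<sigma> \<tau> \<epsilon>)
          \<le> ereal ((2 / pi\<^sup>2 + \<delta> n) * real n ^ 3 * ln (10 * real n / \<epsilon>))"
    if n: "n \<ge> 2" and \<epsilon>: "\<epsilon> \<in> {0<..<1}" and perm: "\<sigma> permutes {..<n}" "\<tau> permutes {..<n}"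
    for n \<epsilon> \<sigma> \<tau>
  proof -
    define l where "l = ln (10 * real n)"
    define L where "L = ln (10 * real n / \<epsilon>)"
    define r where "r = (1 - cos (\<theta> n)) / real (n - 1)"
    \<comment> \<open>The decay must reach \<open>L + 2 * ln l\<close>, the second term cancelling
      \<open>1 / \<eta>\<^sup>2 = l\<^sup>2\<close>. Since \<open>L \<ge> l\<close>, that term is at
      most \<open>L * (2 * ln l / l)\<close>, which makes the time proportional to \<open>L\<close>
      with a factor free of \<epsilon>.\<close>
    define T where "T = 1 / r * (L * (1 + 2 * ln l / l))"
    define t where "t = nat \<lceil>T\<rceil>"
    have l: "l > 1" unfolding l_def using n by (intro ln_ten_mult_ge_1) auto
    have L: "L \<ge> l" unfolding L_def l_def using \<epsilon> n by (subst ln_le_cancel_iff) (auto simp: field_simps)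
    have \<theta>: "\<theta> n * real n = (1 - 1 / l) * pi" using n by (simp add: \<theta>_def l_def)
    have "0 < \<theta> n" using l n by (simp add: \<theta>_def flip: l_def)
    moreover have "\<theta> n < pi"
    proof -
      have "(1 - 1 / l) * pi < 1 * pi" using l by (intro mult_strict_right_mono) auto
      also have "\<dots> \<le> real n * pi" using n by (intro mult_right_mono) auto
      finally have "\<theta> n * real n < pi * real n" unfolding \<theta> by (simp add: mult.commute)
      then show ?thesis using n by simp
    qed
    ultimately have "cos (\<theta> n) < 1"
      using cos_monotone_0_pi[of 0 "\<theta> n"] by simp
    then have r: "r > 0" unfolding r_def using n by simp
    have T: "T \<ge> 0" unfolding T_def using r l L by simp
    have "2 * ln l \<le> L * (2 * ln l / l)"
      using l L by (simp add: field_simps)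
    then have "L + 2 * ln l \<le> r * T" using r by (simp add: T_def algebra_simps)
    also have "\<dots> \<le> r * real t"
      using r T unfolding t_def by (intro mult_left_mono) (auto simp: real_nat_ceiling_ge)
    finally have "exp (- real t * r) \<le> exp (- (L + 2 * ln l))" by (simp add: mult.commute)
    also have "\<dots> = exp (- L) * exp (- ln (l\<^sup>2))"
      using l by (simp add: ln_realpow flip: exp_add)
    also have "\<dots> = \<epsilon> / (10 * real n) / l\<^sup>2"
      using l \<epsilon> n by (simp add: L_def exp_minus field_simps)
    finally have e: "real n / (1 / l)\<^sup>2 * exp (- real t * r) \<le> real n / (1 / l)\<^sup>2 * (\<epsilon> / (10 * real n) / l\<^sup>2)"
      by (intro mult_left_mono) auto
    also have "\<dots> = \<epsilon> / 10" using l n by (simp add: field_simps)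
    also have "\<dots> \<le> \<epsilon>" using \<epsilon> by simp
    finally have "prob_coalesced n \<sigma> \<tau> t \<ge> 1 - \<epsilon>"
      using prob_coalesced_ge[OF \<theta> _ _ n perm, of t] l unfolding r_def by simp
    then have "coalescence_steps n \<sigma> \<tau> \<epsilon> \<le> enat t"
      unfolding coalescence_steps_def by (intro INF_lower) auto
    then have "ereal_of_enat (coalescence_steps n \<sigma> \<tau> \<epsilon>) \<le> ereal (real t)"
      using ereal_of_enat_le_iff[of _ "enat t"] by simp
    also have "real t \<le> T + 1" unfolding t_def using T by linarith
    \<comment> \<open>The unit lost to the ceiling is absorbed into a multiple of \<open>L\<close>,
      as \<open>L \<ge> l > 1\<close>.\<close>
    also have "T + 1 \<le> T + L" using l L by simp
    also have "\<dots> = (1 / (r * real n ^ 3) * (1 + 2 * ln l / l) + 1 / real n ^ 3) * real n ^ 3 * L"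
      using n r l by (simp add: T_def field_simps)
    also have "\<dots> = (2 / pi\<^sup>2 + \<delta> n) * real n ^ 3 * L"
      by (simp add: \<delta>_def r_def l_def)
    finally show ?thesis by (simp add: L_def)
  qed
  ultimately show ?thesis by blast
qed

end
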